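(* Let $n \geq 2$ be an integer, $0<\alpha\leq\infty$, and let $f\colon[0,\alpha)\to\mathbf{R}$ be a continuous function. If $f(0)\leq 0$ and $f$ is $n$-convex in $[0,\alpha)$, then the function $g(t) = f(t)/t$ is $(n-1)$-monotone in $(0,\alpha)$.
   Context: For $m\in\mathbf{N}$, $M_m$ is the algebra of complex $m\times m$ matrices, $\leq$ is the Loewner order on selfadjoint matrices, and $f(a)$ is defined by functional calculus. A function $f\colon I\to\mathbf{R}$ on an interval $I$ is $m$-monotone if $f(a)\leq f(b)$ for every pair of selfadjoint $a,b\in M_m$ with $a\leq b$ and all eigenvalues of $a$ and $b$ in $I$; it is $m$-convex if $f(\lambda a+(1-\lambda)b)\leq \lambda f(a)+(1-\lambda)f(b)$ for all selfadjoint $a,b\in M_m$ with all eigenvalues in $I$ and all $\lambda\in[0,1]$. *)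

theory Defs
  imports
    "HOL-Library.Extended_Real"
    "Jordan_Normal_Form.Schur_Decomposition"
    "Jordan_Normal_Form.Spectral_Radius"
begin

definition selfadjoint_mat :: "complex mat \<Rightarrow> bool" where
  "selfadjoint_mat A \<longleftrightarrow> square_mat A \<and> mat_adjoint A = A"

definition unitary_mat :: "complex mat \<Rightarrow> bool" where
  "unitary_mat U \<longleftrightarrow> square_mat U \<and>
     U * mat_adjoint U = 1\<^sub>m (dim_row U) \<and> mat_adjoint U * U = 1\<^sub>m (dim_row U)"

definition positive_mat :: "complex mat \<Rightarrow> bool" where
  "positive_mat A \<longleftrightarrow> selfadjoint_mat A \<and>
     (\<forall>v \<in> carrier_vec (dim_row A). 0 \<le> Re ((A *\<^sub>v v) \<bullet>c v))"

definition loewner_le :: "complex mat \<Rightarrow> complex mat \<Rightarrow> bool" where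
  "loewner_le A B \<longleftrightarrow> positive_mat (B - A)"

text \<open>The graph of the functional calculus: \<open>f (U diag(d) U\<^sup>*) = U diag(f \<circ> d) U\<^sup>*\<close> for unitary
  \<open>U\<close> and real \<open>d\<close>.  The diagonalisation is not unique, but the result does not depend on it
  (\<open>is_fun_calc_unique\<close> below); only the values of \<open>f\<close> on the spectrum of \<open>A\<close> matter.\<close>

definition is_fun_calc :: "(real \<Rightarrow> real) \<Rightarrow> complex mat \<Rightarrow> complex mat \<Rightarrow> bool" where
  "is_fun_calc f A B \<longleftrightarrow> (\<exists>U d. U \<in> carrier_mat (dim_row A) (dim_row A) \<and> unitary_mat U \<and>
     A = U * mat_diag (dim_row A) (\<lambda>i. complex_of_real (d i)) * mat_adjoint U \<and>
     B = U * mat_diag (dim_row A) (\<lambda>i. complex_of_real (f (d i))) * mat_adjoint U)"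

definition fun_calc :: "(real \<Rightarrow> real) \<Rightarrow> complex mat \<Rightarrow> complex mat" where
  "fun_calc f A = (THE B. is_fun_calc f A B)"

definition eigenvalues_in :: "complex mat \<Rightarrow> real set \<Rightarrow> bool" where
  "eigenvalues_in A I \<longleftrightarrow> spectrum A \<subseteq> complex_of_real ` I"

definition matrix_monotone :: "nat \<Rightarrow> real set \<Rightarrow> (real \<Rightarrow> real) \<Rightarrow> bool" where
  "matrix_monotone m I f \<longleftrightarrow>
     (\<forall>a \<in> carrier_mat m m. \<forall>b \<in> carrier_mat m m.
        selfadjoint_mat a \<longrightarrow> selfadjoint_mat b \<longrightarrow>
        eigenvalues_in a I \<longrightarrow> eigenvalues_in b I \<longrightarrow>
        loewner_le a b \<longrightarrow> loewner_le (fun_calc f a) (fun_calc f b))"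

definition matrix_convex :: "nat \<Rightarrow> real set \<Rightarrow> (real \<Rightarrow> real) \<Rightarrow> bool" where
  "matrix_convex m I f \<longleftrightarrow>
     (\<forall>a \<in> carrier_mat m m. \<forall>b \<in> carrier_mat m m. \<forall>l \<in> {0..1::real}.
        selfadjoint_mat a \<longrightarrow> selfadjoint_mat b \<longrightarrow>
        eigenvalues_in a I \<longrightarrow> eigenvalues_in b I \<longrightarrow>
        loewner_le
          (fun_calc f (complex_of_real l \<cdot>\<^sub>m a + complex_of_real (1 - l) \<cdot>\<^sub>m b))
          (complex_of_real l \<cdot>\<^sub>m fun_calc f a + complex_of_real (1 - l) \<cdot>\<^sub>m fun_calc f b))"

lemma mat_adjoint_carrier:
  "U \<in> carrier_mat n m \<Longrightarrow> mat_adjoint U \<in> carrier_mat m n"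
  unfolding mat_adjoint_def by auto

lemma is_fun_calc_unique:
  assumes "is_fun_calc f A B" and "is_fun_calc f A C"
  shows "B = C"
proof -
  define n where "n = dim_row A"
  let ?D = "\<lambda>d. mat_diag n (\<lambda>i. complex_of_real (d i))"
  from assms obtain U d V e where
    U: "U \<in> carrier_mat n n" "unitary_mat U" and V: "V \<in> carrier_mat n n" "unitary_mat V"
    and A1: "A = U * ?D d * mat_adjoint U" and A2: "A = V * ?D e * mat_adjoint V"
    and B: "B = U * ?D (f \<circ> d) * mat_adjoint U" and C: "C = V * ?D (f \<circ> e) * mat_adjoint V"
    unfolding is_fun_calc_def n_def comp_def by blast
  define X Y where "X = mat_adjoint U" and "Y = mat_adjoint V"
  have [simp]: "X \<in> carrier_mat n n" "Y \<in> carrier_mat n n" "U \<in> carrier_mat n n" "V \<in> carrier_mat n n"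
    using U V mat_adjoint_carrier unfolding X_def Y_def by auto
  have XU: "X * U = 1\<^sub>m n" "U * X = 1\<^sub>m n" "Y * V = 1\<^sub>m n" "V * Y = 1\<^sub>m n"
    using U(2) V(2) carrier_matD(1)[OF U(1)] carrier_matD(1)[OF V(1)]
    unfolding X_def Y_def unitary_mat_def by simp_all
  have cl: "M * N \<in> carrier_mat n n"
    if "M \<in> carrier_mat n n" "N \<in> carrier_mat n n" for M N :: "complex mat"
    using that by (rule mult_carrier_mat)
  note as = assoc_mult_mat[of _ n n _ n _ n] cl
  define W where "W = Y * U"
  have W[simp]: "W \<in> carrier_mat n n" unfolding W_def by (rule cl) auto
  have D[simp]: "?D q \<in> carrier_mat n n" for q by (simp add: mat_diag_def)
  have s1: "Y * (U * P * X) * U = W * P" if P: "P \<in> carrier_mat n n" for P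
    using P XU unfolding W_def by (simp add: as)
  have s2: "Y * (V * P * Y) * U = P * W" if P: "P \<in> carrier_mat n n" for P
  proof -
    have "Y * (V * P * Y) * U = (Y * V) * P * (Y * U)"
      using P by (simp add: as)
    then show ?thesis using P XU unfolding W_def by simp
  qed
  have WD: "W * ?D d = ?D e * W"
    using A1 A2 s1[OF D] s2[OF D] unfolding X_def Y_def by metis
  have ent: "W $$ (i,j) * complex_of_real (d j) = complex_of_real (e i) * W $$ (i,j)"
    if "i < n" "j < n" for i j
    using arg_cong[OF WD, of "\<lambda>M. M $$ (i,j)"] that
    by (simp add: mat_diag_mult_left[OF W] mat_diag_mult_right[OF W])
  have fWD: "W * ?D (f \<circ> d) = ?D (f \<circ> e) * W"
  proof (rule eq_matI)
    fix i j assume ij: "i < dim_row (?D (f \<circ> e) * W)" "j < dim_col (?D (f \<circ> e) * W)"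
    then have ij': "i < n" "j < n" using carrier_matD[OF W] by (auto simp: mat_diag_def)
    have "W $$ (i,j) = 0 \<or> d j = e i" using ent[OF ij'] by auto
    then show "(W * ?D (f \<circ> d)) $$ (i,j) = (?D (f \<circ> e) * W) $$ (i,j)"
      using ij' by (auto simp: mat_diag_mult_left[OF W] mat_diag_mult_right[OF W])
  qed (use carrier_matD[OF W] in \<open>auto simp: mat_diag_def\<close>)
  have "Y * B * U = Y * C * U"
    using s1[OF D[of "f \<circ> d"]] s2[OF D[of "f \<circ> e"]] fWD unfolding B C X_def Y_def by simp
  moreover have "V * (Y * M * U) * X = M" if "M \<in> carrier_mat n n" for M
  proof -
    have "V * (Y * M * U) * X = (V * Y) * M * (U * X)"
      using that by (simp add: as)
    then show ?thesis using that XU by simp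
  qed
  moreover have "B \<in> carrier_mat n n" "C \<in> carrier_mat n n"
    unfolding B C X_def[symmetric] Y_def[symmetric] by (auto intro!: cl)
  ultimately show ?thesis by metis
qed

lemma fun_calc_eq: "is_fun_calc f A B \<Longrightarrow> fun_calc f A = B"
  unfolding fun_calc_def using is_fun_calc_unique by blast

end

theory Submission
  imports Defs
begin

text \<open>Let \<open>m = n - 1\<close>. Suppose first that \<open>b = a + \<xi> \<xi>\<^sup>*\<close> is a rank one increase, and write
  \<open>a = S S\<^sup>*\<close> with \<open>S = W \<Lambda>\<^sup>1\<^sup>/\<^sup>2\<close>, where \<open>a = W \<Lambda> W\<^sup>*\<close>. For the \<open>m \<times> (m + 1)\<close> matrix \<open>T = (S, \<xi>)\<close> we
  have \<open>T T\<^sup>* = b\<close>, so \<open>X = T\<^sup>* T\<close> has the eigenvalues of \<open>b\<close> together with \<open>0\<close>, and \<open>f X\<close> agrees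
  with \<open>T\<^sup>* g(b) T\<close> up to \<open>f 0 \<le> 0\<close> times a projection. Replacing \<open>\<xi>\<close> by \<open>-\<xi>\<close> flips the off-diagonal
  blocks of \<open>X\<close>, so the mean of the two matrices is the diagonal matrix \<open>\<Lambda> \<oplus> \<parallel>\<xi>\<parallel>\<^sup>2\<close>. Convexity of \<open>f\<close>
  on \<open>(m + 1) \<times> (m + 1)\<close> matrices, read in the upper left block, is \<open>f \<Lambda> \<le> S\<^sup>* g(b) S\<close>, that is,
  \<open>g(a) \<le> g(b)\<close>. In general \<open>b - a\<close> is a sum of positive rank one matrices, and the intermediate
  matrices have spectrum in the interval because they lie between \<open>a\<close> and \<open>b\<close>.\<close>

section \<open>Matrix algebra: diagonal matrices, products and adjoints\<close>

lemma mat_diag_dims [simp]: "dim_row (mat_diag n d) = n" "dim_col (mat_diag n d) = n"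
  by (simp_all add: mat_diag_def)

lemma mat_diag_cong: "(\<And>i. i < n \<Longrightarrow> d i = e i) \<Longrightarrow> mat_diag n d = mat_diag n e"
  by (intro eq_matI) (auto simp: mat_diag_def)

lemma mat_diag_mult_vec:
  assumes "v \<in> carrier_vec n" "i < n"
  shows "(mat_diag n d *\<^sub>v v) $ i = d i * v $ i"
proof -
  have "(mat_diag n d *\<^sub>v v) $ i = (\<Sum>j<n. (if i = j then d j else 0) * v $ j)"
    using assms by (simp add: mat_diag_def scalar_prod_def atLeast0LessThan)
  also have "\<dots> = (\<Sum>j<n. if j = i then d j * v $ j else 0)"
    by (intro sum.cong) auto
  finally show ?thesis using assms(2) by simp
qed

text \<open>The hypotheses are equations between dimensions rather than carrier memberships: as a
  conditional rewrite rule this has no free dimension to guess, and simp settles the side conditions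
  once the dimensions of the factors are given.\<close>

lemma mat_mult_assoc:
  fixes A B C :: "complex mat"
  assumes "dim_col A = dim_row B" "dim_col B = dim_row C"
  shows "A * B * C = A * (B * C)"
  using assms by (intro assoc_mult_mat) auto

lemma mat_mult_smult:
  fixes A B :: "complex mat"
  assumes "dim_col A = dim_row B"
  shows "A * (c \<cdot>\<^sub>m B) = c \<cdot>\<^sub>m (A * B)" "c \<cdot>\<^sub>m A * B = c \<cdot>\<^sub>m (A * B)"
  using assms by (auto intro!: mult_smult_distrib mult_smult_assoc_mat)

lemma mat_add_zero:
  fixes A :: "complex mat"
  assumes "dim_row A = n" "dim_col A = m"
  shows "A + 0\<^sub>m n m = A" "0\<^sub>m n m + A = A"
  using assms by (auto intro!: eq_matI)

lemma mat_adjoint_dims [simp]: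
  "dim_row (mat_adjoint A) = dim_col A" "dim_col (mat_adjoint A) = dim_row A"
  by (simp_all add: mat_adjoint_def)

lemma mat_adjoint_index [simp]:
  fixes A :: "complex mat"
  assumes "i < dim_col A" "j < dim_row A"
  shows "mat_adjoint A $$ (i, j) = cnj (A $$ (j, i))"
  using assms by (simp add: mat_adjoint_def mat_of_rows_index)

lemma mat_adjoint_mat_adjoint [simp]:
  fixes A :: "complex mat"
  shows "mat_adjoint (mat_adjoint A) = A"
  by (rule eq_matI) auto

lemma mat_adjoint_mult:
  fixes A B :: "complex mat"
  assumes "dim_col A = dim_row B"
  shows "mat_adjoint (A * B) = mat_adjoint B * mat_adjoint A"
  using assms by (intro eq_matI) (auto simp: scalar_prod_def intro!: sum.cong)

lemma mat_adjoint_add: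
  fixes A B :: "complex mat"
  assumes "A \<in> carrier_mat n m" "B \<in> carrier_mat n m"
  shows "mat_adjoint (A + B) = mat_adjoint A + mat_adjoint B"
  using assms by (intro eq_matI) auto

lemma mat_adjoint_minus:
  fixes A B :: "complex mat"
  assumes "A \<in> carrier_mat n m" "B \<in> carrier_mat n m"
  shows "mat_adjoint (A - B) = mat_adjoint A - mat_adjoint B"
  using assms by (intro eq_matI) auto

lemma mat_adjoint_smult:
  fixes A :: "complex mat"
  shows "mat_adjoint (c \<cdot>\<^sub>m A) = cnj c \<cdot>\<^sub>m mat_adjoint A"
  by (intro eq_matI) auto

lemma mat_adjoint_one [simp]: "mat_adjoint (1\<^sub>m n :: complex mat) = 1\<^sub>m n"
  by (intro eq_matI) auto

lemma mat_adjoint_zero [simp]: "mat_adjoint (0\<^sub>m n m :: complex mat) = 0\<^sub>m m n"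
  by (intro eq_matI) auto

lemma mat_adjoint_diag_real [simp]:
  "mat_adjoint (mat_diag n (\<lambda>i. complex_of_real (d i))) = mat_diag n (\<lambda>i. complex_of_real (d i))"
  by (intro eq_matI) (auto simp: mat_diag_def)

lemma mat_adjoint_four_block:
  fixes A B C D :: "complex mat"
  assumes "A \<in> carrier_mat n k" "B \<in> carrier_mat n l" "C \<in> carrier_mat m k" "D \<in> carrier_mat m l"
  shows "mat_adjoint (four_block_mat A B C D) =
    four_block_mat (mat_adjoint A) (mat_adjoint C) (mat_adjoint B) (mat_adjoint D)"
  using assms by (intro eq_matI) auto

section \<open>Inner products and unitary matrices\<close>

lemma cscalar_prod_mult_mat_left:
  fixes A :: "complex mat"
  assumes A: "A \<in> carrier_mat n m" and v: "v \<in> carrier_vec m" and w: "w \<in> carrier_vec n"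
  shows "(A *\<^sub>v v) \<bullet>c w = v \<bullet>c (mat_adjoint A *\<^sub>v w)"
proof -
  have "(A *\<^sub>v v) \<bullet>c w = (\<Sum>i<n. \<Sum>j<m. A $$ (i, j) * v $ j * cnj (w $ i))"
    using assms by (simp add: scalar_prod_def sum_distrib_right atLeast0LessThan)
  also have "\<dots> = (\<Sum>j<m. \<Sum>i<n. A $$ (i, j) * v $ j * cnj (w $ i))"
    by (rule sum.swap)
  also have "\<dots> = v \<bullet>c (mat_adjoint A *\<^sub>v w)"
    using assms by (simp add: scalar_prod_def sum_distrib_left atLeast0LessThan mult_ac)
  finally show ?thesis .
qed

lemma cscalar_prod_self:
  fixes v :: "complex vec"
  assumes "v \<in> carrier_vec n"
  shows "v \<bullet>c v = complex_of_real (\<Sum>i<n. (cmod (v $ i))\<^sup>2)"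
  using assms by (simp add: scalar_prod_def atLeast0LessThan complex_norm_square[symmetric])

text \<open>For square matrices a left inverse is also a right inverse, so orthonormal columns
  suffice.\<close>

lemma unitary_matI:
  assumes "U \<in> carrier_mat n n" "mat_adjoint U * U = 1\<^sub>m n"
  shows "unitary_mat U"
  using assms mat_mult_left_right_inverse[of "mat_adjoint U" n U]
  by (auto simp: unitary_mat_def mat_adjoint_carrier)

lemma unitary_matD:
  assumes "U \<in> carrier_mat n n" "unitary_mat U"
  shows "mat_adjoint U * U = 1\<^sub>m n" "U * mat_adjoint U = 1\<^sub>m n"
  using assms by (auto simp: unitary_mat_def)

lemma unitary_mat_mult:
  assumes U: "U \<in> carrier_mat n n" "unitary_mat U" and V: "V \<in> carrier_mat n n" "unitary_mat V"
  shows "unitary_mat (U * V)"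
proof (rule unitary_matI)
  note dims = carrier_matD[OF U(1)] carrier_matD[OF V(1)]
  have "mat_adjoint (U * V) * (U * V) = mat_adjoint V * ((mat_adjoint U * U) * V)"
    by (simp add: mat_adjoint_mult mat_mult_assoc dims)
  then show "mat_adjoint (U * V) * (U * V) = 1\<^sub>m n"
    by (simp add: unitary_matD[OF U] unitary_matD[OF V] dims)
qed (use assms in auto)

lemma selfadjoint_matD: "A \<in> carrier_mat n n \<Longrightarrow> selfadjoint_mat A \<Longrightarrow> mat_adjoint A = A"
  by (simp add: selfadjoint_mat_def)

lemma selfadjoint_matI: "A \<in> carrier_mat n n \<Longrightarrow> mat_adjoint A = A \<Longrightarrow> selfadjoint_mat A"
  by (simp add: selfadjoint_mat_def)

lemma selfadjoint_add:
  assumes "A \<in> carrier_mat n n" "selfadjoint_mat A" "B \<in> carrier_mat n n" "selfadjoint_mat B"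
  shows "selfadjoint_mat (A + B)"
  using assms by (intro selfadjoint_matI[of _ n]) (auto simp: mat_adjoint_add[of _ n n] selfadjoint_matD)

lemma selfadjoint_conj:
  assumes A: "A \<in> carrier_mat n n" "selfadjoint_mat A" and U: "U \<in> carrier_mat n m"
  shows "selfadjoint_mat (mat_adjoint U * A * U)"
proof (rule selfadjoint_matI)
  note dims = carrier_matD[OF A(1)] carrier_matD[OF U]
  show "mat_adjoint U * A * U \<in> carrier_mat m m"
    by (rule carrier_matI) (simp_all add: dims)
  show "mat_adjoint (mat_adjoint U * A * U) = mat_adjoint U * A * U"
    using selfadjoint_matD[OF A] by (simp add: mat_adjoint_mult mat_mult_assoc dims)
qed

section \<open>The spectral theorem for selfadjoint matrices\<close>

text \<open>Complete \<open>v\<close> to a basis and apply Gram-Schmidt, which leaves the first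
  vector unchanged. Its output is orthogonal but not normalised, so each column still has to be
  divided by its length, and column 0 becomes a multiple of \<open>v\<close>.\<close>

lemma unitary_with_first_column:
  fixes v :: "complex vec"
  assumes v: "v \<in> carrier_vec n" and v0: "v \<noteq> 0\<^sub>v n"
  obtains W c where "W \<in> carrier_mat n n" "unitary_mat W" "col W 0 = c \<cdot>\<^sub>v v"
proof -
  interpret cof_vec_space n "TYPE(complex)" .
  from v v0 have n: "n > 0" by (cases n) auto
  define ws where "ws = gram_schmidt n (basis_completion v)"
  note b = basis_completion[OF v v0]
  note gs = gram_schmidt_result[OF b(2,4,5) refl, folded ws_def]
  have len: "length ws = n" using gs(4) b(6) by simp
  have wsc: "ws ! i \<in> carrier_vec n" if "i < n" for i using gs(3) len that by auto
  obtain vs where "basis_completion v = v # vs"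
    using b(6,7) n by (cases "basis_completion v") auto
  then have "hd ws = v"
    unfolding ws_def using gram_schmidt_hd[OF v, of vs] by simp
  then have ws0: "ws ! 0 = v" using len n by (metis hd_conv_nth length_greater_0_conv)
  define r where "r = (\<lambda>i. \<Sum>k<n. (cmod (ws ! i $ k))\<^sup>2)"
  have r: "ws ! i \<bullet>c ws ! i = complex_of_real (r i)" if "i < n" for i
    using cscalar_prod_self[OF wsc[OF that]] by (simp add: r_def)
  have orth: "ws ! i \<bullet>c ws ! j = 0 \<longleftrightarrow> i \<noteq> j" if "i < n" "j < n" for i j
    using corthogonalD[OF gs(2)] that len by simp
  \<comment> \<open>The diagonal case of \<open>orth\<close> says that no vector of
    \<open>ws\<close> is isotropic, which makes the normalisation legitimate.\<close>
  have rpos: "r i > 0" if "i < n" for i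
  proof -
    have "r i \<noteq> 0" using orth[OF that that] r[OF that] by auto
    moreover have "r i \<ge> 0" by (simp add: r_def sum_nonneg)
    ultimately show ?thesis by simp
  qed
  define W where "W = mat n n (\<lambda>(i,j). ws ! j $ i / complex_of_real (sqrt (r j)))"
  have W: "W \<in> carrier_mat n n" by (simp add: W_def)
  have "(mat_adjoint W * W) $$ (i, j) = (if i = j then 1 else 0)" if ij: "i < n" "j < n" for i j
  proof -
    have "(mat_adjoint W * W) $$ (i, j) =
        (ws ! j \<bullet>c ws ! i) / complex_of_real (sqrt (r i) * sqrt (r j))"
      using ij wsc[OF ij(1)] wsc[OF ij(2)]
      by (simp add: W_def scalar_prod_def sum_divide_distrib mult_ac)
    also have "\<dots> = (if i = j then 1 else 0)"
    proof (cases "i = j")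
      case True
      then show ?thesis using r[OF ij(1)] rpos[OF ij(1)] by (simp flip: of_real_mult)
    next
      case False
      then show ?thesis using orth[OF ij(2,1)] by simp
    qed
    finally show ?thesis .
  qed
  then have "mat_adjoint W * W = 1\<^sub>m n" using W by (intro eq_matI) auto
  then have "unitary_mat W" by (rule unitary_matI[OF W])
  moreover have "col W 0 = (1 / complex_of_real (sqrt (r 0))) \<cdot>\<^sub>v v"
    using n v ws0 by (intro eq_vecI) (auto simp: W_def)
  ultimately show ?thesis using W that by blast
qed

abbreviation real_diag :: "nat \<Rightarrow> (nat \<Rightarrow> real) \<Rightarrow> complex mat" where
  "real_diag n d \<equiv> mat_diag n (\<lambda>i. complex_of_real (d i))"

text \<open>The unitary and the eigenvalues are kept as separate arguments, so that functional
  calculus becomes an operation on the last argument alone.\<close>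

definition unitary_diag :: "nat \<Rightarrow> complex mat \<Rightarrow> (nat \<Rightarrow> real) \<Rightarrow> complex mat" where
  "unitary_diag n U d = U * real_diag n d * mat_adjoint U"

text \<open>Deflation: a unitary \<open>W\<close> whose first column is an eigenvector turns
  \<open>A\<close> into a block diagonal matrix with blocks \<open>e\<close> and \<open>C\<close>.
  The induction hypothesis diagonalises the smaller selfadjoint block \<open>C\<close> by some
  \<open>P\<close>, and \<open>W\<close> times the direct sum of 1 and \<open>P\<close> diagonalises
  \<open>A\<close>.\<close>

theorem spectral_decomposition:
  assumes "A \<in> carrier_mat n n" "selfadjoint_mat A"
  obtains U d where "U \<in> carrier_mat n n" "unitary_mat U"
    "A = unitary_diag n U d"
  using assms
proof (induction n arbitrary: A thesis)
  case 0
  have "unitary_mat (1\<^sub>m 0)" by (simp add: unitary_mat_def)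
  moreover have "A = unitary_diag 0 (1\<^sub>m 0) (\<lambda>_. 0)"
    using "0.prems"(2) by (intro eq_matI) (auto simp: unitary_diag_def)
  ultimately show ?case using "0.prems"(1)[of "1\<^sub>m 0"] by simp
next
  case (Suc m)
  note A = Suc.prems(2) and sa = Suc.prems(3)
  let ?n = "Suc m"
  obtain e where "eigenvalue A e"
    using spectrum_non_empty[OF A] by (auto simp: spectrum_def)
  then obtain v where v: "v \<in> carrier_vec ?n" "v \<noteq> 0\<^sub>v ?n" "A *\<^sub>v v = e \<cdot>\<^sub>v v"
    using A by (auto simp: eigenvalue_def eigenvector_def)
  obtain W c where W: "W \<in> carrier_mat ?n ?n" "unitary_mat W" and W0: "col W 0 = c \<cdot>\<^sub>v v"
    using unitary_with_first_column[OF v(1,2)] by blast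
  note W' [simp] = mat_adjoint_carrier[OF W(1)] W(1) A
  note as = assoc_mult_mat[of _ ?n ?n _ ?n _ ?n] mult_carrier_mat[of _ ?n ?n _ ?n]
  note WW = unitary_matD[OF W]
  define B where "B = mat_adjoint W * A * W"
  have B [simp]: "B \<in> carrier_mat ?n ?n" unfolding B_def by (intro as) (rule W')+
  have saB: "mat_adjoint B = B"
    using selfadjoint_conj[OF A sa W(1)] B unfolding B_def[symmetric] by (rule selfadjoint_matD[rotated])
  have AB: "A = W * B * mat_adjoint W"
  proof -
    have "W * B * mat_adjoint W = (W * mat_adjoint W) * A * (W * mat_adjoint W)"
      unfolding B_def by (simp add: as)
    then show ?thesis using WW A by simp
  qed
  \<comment> \<open>Column 0 of \<open>W\<close> is an eigenvector of \<open>A\<close>, and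
    \<open>W\<close> carries the first unit vector to it, so the first unit vector is an eigenvector
    of \<open>B\<close>. Selfadjointness then clears row 0 as well.\<close>
  have "col B 0 = mat_adjoint W *\<^sub>v (A *\<^sub>v col W 0)"
    unfolding B_def by (simp add: as col_mult2[of _ ?n ?n _ ?n])
  also have "\<dots> = e \<cdot>\<^sub>v (mat_adjoint W *\<^sub>v col W 0)"
    using v by (simp add: W0 mult_mat_vec[of _ ?n ?n] smult_smult_assoc mult.commute)
  also have "mat_adjoint W *\<^sub>v col W 0 = col (mat_adjoint W * W) 0"
    by (simp add: col_mult2[of _ ?n ?n _ ?n])
  also have "\<dots> = unit_vec ?n 0" by (simp add: WW)
  finally have colB: "col B 0 = e \<cdot>\<^sub>v unit_vec ?n 0" .
  have col0: "B $$ (i, 0) = (if i = 0 then e else 0)" if "i < ?n" for i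
  proof -
    have "B $$ (i, 0) = col B 0 $ i" using that carrier_matD[OF B] by simp
    then show ?thesis unfolding colB using that by simp
  qed
  have saB': "B $$ (i, j) = cnj (B $$ (j, i))" if "i < ?n" "j < ?n" for i j
    using arg_cong[OF saB, of "\<lambda>M. M $$ (i, j)"] that B by simp
  have row0: "B $$ (0, j) = 0" if "0 < j" "j < ?n" for j
    using saB'[of 0 j] col0[of j] that by simp
  \<comment> \<open>The eigenvalue is a diagonal entry of a selfadjoint matrix, hence real.\<close>
  have "cnj e = e" using saB'[of 0 0] col0[of 0] by simp
  then obtain x where x: "e = complex_of_real x" by (metis Reals_cases Reals_cnj_iff)
  define C where "C = mat m m (\<lambda>(i,j). B $$ (Suc i, Suc j))"
  have C: "C \<in> carrier_mat m m" by (simp add: C_def)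
  have "selfadjoint_mat C"
    by (intro selfadjoint_matI[OF C] eq_matI) (auto simp: C_def simp flip: saB')
  then obtain P d where P: "P \<in> carrier_mat m m" "unitary_mat P"
    and CP: "C = P * real_diag m d * mat_adjoint P"
    using Suc.IH[OF _ C] unfolding unitary_diag_def by blast
  \<comment> \<open>The split-off eigenvalue takes index 0 and those of \<open>C\<close> move up by
    one, matching the blocks of \<open>Q\<close>.\<close>
  define D where "D = (\<lambda>i. case i of 0 \<Rightarrow> x | Suc j \<Rightarrow> d j)"
  define Q where "Q = four_block_mat (1\<^sub>m 1) (0\<^sub>m 1 m) (0\<^sub>m m 1) P"
  note P' [simp] = P(1) mat_adjoint_carrier[OF P(1)]
  have Q: "Q \<in> carrier_mat ?n ?n"
    unfolding Q_def using four_block_carrier_mat[of "1\<^sub>m 1" 1 1 P m m] by simp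
  have Qa: "mat_adjoint Q = four_block_mat (1\<^sub>m 1) (0\<^sub>m 1 m) (0\<^sub>m m 1) (mat_adjoint P)"
    unfolding Q_def by (subst mat_adjoint_four_block[of _ 1 1 _ m _ m]) auto
  have "mat_adjoint Q * Q = 1\<^sub>m ?n"
    unfolding Qa unfolding Q_def
    by (subst mult_four_block_mat[of _ 1 1 _ m _ m _ _ 1 _ m])
      (auto simp: unitary_matD[OF P] carrier_matD[OF P(1)])
  then have uQ: "unitary_mat Q" by (rule unitary_matI[OF Q])
  let ?D = "real_diag ?n D"
  have D4: "?D = four_block_mat (e \<cdot>\<^sub>m 1\<^sub>m 1) (0\<^sub>m 1 m) (0\<^sub>m m 1) (real_diag m d)"
    by (intro eq_matI) (auto simp: mat_diag_def D_def x split: nat.splits)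
  have "Q * ?D = four_block_mat (e \<cdot>\<^sub>m 1\<^sub>m 1) (0\<^sub>m 1 m) (0\<^sub>m m 1) (P * real_diag m d)"
    unfolding D4 Q_def
    by (subst mult_four_block_mat[of _ 1 1 _ m _ m _ _ 1 _ m]) (auto simp: carrier_matD[OF P(1)])
  then have "Q * ?D * mat_adjoint Q =
      four_block_mat (e \<cdot>\<^sub>m 1\<^sub>m 1) (0\<^sub>m 1 m) (0\<^sub>m m 1) (P * real_diag m d) * mat_adjoint Q"
    by simp
  also have "\<dots> = four_block_mat (e \<cdot>\<^sub>m 1\<^sub>m 1) (0\<^sub>m 1 m) (0\<^sub>m m 1) C"
    unfolding Qa CP
    by (subst mult_four_block_mat[of _ 1 1 _ m _ m _ _ 1 _ m]) (auto simp: carrier_matD[OF P(1)])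
  also have "\<dots> = B"
    by (intro eq_matI) (auto simp: C_def col0 row0 carrier_matD[OF B])
  finally have BQ: "B = Q * ?D * mat_adjoint Q" ..
  have "A = unitary_diag ?n (W * Q) D"
    unfolding AB BQ unitary_diag_def using carrier_matD[OF Q] carrier_matD[OF W(1)]
    by (simp add: mat_mult_assoc mat_adjoint_mult)
  moreover have "unitary_mat (W * Q)" by (rule unitary_mat_mult) (use W Q uQ in auto)
  moreover have "W * Q \<in> carrier_mat ?n ?n" using Q by (intro as) auto
  ultimately show ?case using Suc.prems(1) by blast
qed

section \<open>Functional calculus, quadratic forms and spectra of diagonalised matrices\<close>

lemma unitary_diag_carrier [simp]:
  assumes "U \<in> carrier_mat n n"
  shows "unitary_diag n U d \<in> carrier_mat n n"
  using assms mat_adjoint_carrier[OF assms]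
  by (auto simp: unitary_diag_def intro!: mult_carrier_mat[of _ n n _ n])

lemma selfadjoint_unitary_diag:
  assumes "U \<in> carrier_mat n n"
  shows "selfadjoint_mat (unitary_diag n U d)"
  using selfadjoint_conj[of "real_diag n d" n "mat_adjoint U" n] mat_adjoint_carrier[OF assms]
  by (simp add: unitary_diag_def selfadjoint_matI[OF mat_diag_dim mat_adjoint_diag_real])

text \<open>By uniqueness of the functional calculus, any diagonalisation at hand may be used to
  compute it.\<close>

lemma fun_calc_unitary_diag:
  assumes "U \<in> carrier_mat n n" "unitary_mat U"
  shows "fun_calc f (unitary_diag n U d) = unitary_diag n U (\<lambda>i. f (d i))"
proof (rule fun_calc_eq)
  have "dim_row (unitary_diag n U d) = n" using unitary_diag_carrier[OF assms(1), of d] by auto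
  then show "is_fun_calc f (unitary_diag n U d) (unitary_diag n U (\<lambda>i. f (d i)))"
    using assms unfolding is_fun_calc_def unitary_diag_def by auto
qed

text \<open>This is the expression in \<open>positive_mat\<close>, so the Loewner order between
  selfadjoint matrices becomes a pointwise inequality between real-valued functions of
  \<open>v\<close>.\<close>

definition qform :: "complex mat \<Rightarrow> complex vec \<Rightarrow> real" where
  "qform A v = Re ((A *\<^sub>v v) \<bullet>c v)"

text \<open>Moving the left factor \<open>U\<close> across the inner product leaves a diagonal form
  in the coordinates of \<open>mat_adjoint U *\<^sub>v v\<close>.\<close>

lemma qform_unitary_diag:
  assumes U: "U \<in> carrier_mat n n" and v: "v \<in> carrier_vec n"
  shows "qform (unitary_diag n U d) v = (\<Sum>i<n. d i * (cmod ((mat_adjoint U *\<^sub>v v) $ i))\<^sup>2)"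
proof -
  define u where "u = mat_adjoint U *\<^sub>v v"
  note U' = mat_adjoint_carrier[OF U]
  have u: "u \<in> carrier_vec n" unfolding u_def using U' v by simp
  have Du: "real_diag n d *\<^sub>v u \<in> carrier_vec n"
    using u by (metis mat_diag_dim mult_mat_vec_carrier)
  have "unitary_diag n U d *\<^sub>v v = U *\<^sub>v (real_diag n d *\<^sub>v u)"
    unfolding unitary_diag_def u_def using U U' v
    by (simp add: assoc_mult_mat_vec[of _ n n _ n] mult_carrier_mat[of _ n n _ n]
        mult_mat_vec_carrier[of _ n n])
  then have "(unitary_diag n U d *\<^sub>v v) \<bullet>c v = (real_diag n d *\<^sub>v u) \<bullet>c u"
    using cscalar_prod_mult_mat_left[OF U Du v] by (simp add: u_def)
  also have "\<dots> = (\<Sum>i<n. complex_of_real (d i) * u $ i * cnj (u $ i))"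
    using u Du by (simp add: scalar_prod_def atLeast0LessThan mat_diag_mult_vec del: index_mult_mat_vec)
  also have "\<dots> = complex_of_real (\<Sum>i<n. d i * (cmod (u $ i))\<^sup>2)"
    by (simp add: mult.assoc complex_norm_square[symmetric])
  finally show ?thesis by (simp add: qform_def u_def)
qed

lemma unitary_adjoint_mult_col:
  assumes "U \<in> carrier_mat n n" "unitary_mat U" "k < n"
  shows "mat_adjoint U *\<^sub>v col U k = unit_vec n k"
proof -
  have "mat_adjoint U *\<^sub>v col U k = col (mat_adjoint U * U) k"
    using assms by (simp add: col_mult2[OF mat_adjoint_carrier[OF assms(1)] assms(1)])
  then show ?thesis using assms by (simp add: unitary_matD[OF assms(1,2)])
qed

lemma qform_unitary_diag_col:
  assumes "U \<in> carrier_mat n n" "unitary_mat U" "k < n"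
  shows "qform (unitary_diag n U d) (col U k) = d k"
proof -
  have v: "col U k \<in> carrier_vec n" using assms by simp
  have "qform (unitary_diag n U d) (col U k) = (\<Sum>i<n. if i = k then d i else 0)"
    unfolding qform_unitary_diag[OF assms(1) v] unitary_adjoint_mult_col[OF assms]
    using assms by (intro sum.cong) (auto simp: unit_vec_def)
  then show ?thesis using assms by simp
qed

text \<open>Parseval's identity: the adjoint of a unitary matrix is an isometry.\<close>

lemma unitary_sum_cmod:
  assumes U: "U \<in> carrier_mat n n" "unitary_mat U" and v: "v \<in> carrier_vec n"
  shows "(\<Sum>i<n. (cmod ((mat_adjoint U *\<^sub>v v) $ i))\<^sup>2) = (\<Sum>i<n. (cmod (v $ i))\<^sup>2)"
proof -
  note U' = mat_adjoint_carrier[OF U(1)]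
  have u: "mat_adjoint U *\<^sub>v v \<in> carrier_vec n" using U' v by simp
  have "(mat_adjoint U *\<^sub>v v) \<bullet>c (mat_adjoint U *\<^sub>v v) = v \<bullet>c v"
    using cscalar_prod_mult_mat_left[OF U' v u] U U' v
    by (simp add: unitary_matD flip: assoc_mult_mat_vec[of _ n n _ n])
  then show ?thesis
    unfolding cscalar_prod_self[OF u] cscalar_prod_self[OF v] using of_real_eq_iff by blast
qed

text \<open>Similar matrices share their characteristic polynomial, and that of a diagonal matrix
  splits into its entries.\<close>

lemma spectrum_unitary_diag:
  assumes U: "U \<in> carrier_mat n n" "unitary_mat U"
  shows "spectrum (unitary_diag n U d) = complex_of_real ` d ` {..<n}"
proof -
  let ?D = "real_diag n d"
  have "similar_mat_wit (unitary_diag n U d) ?D U (mat_adjoint U)"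
    using U mat_adjoint_carrier[OF U(1)] unitary_matD[OF U]
    by (intro similar_mat_witI[of _ _ n]) (auto simp: unitary_diag_def[symmetric])
  then have "char_poly (unitary_diag n U d) = char_poly ?D"
    by (intro char_poly_similar) (auto simp: similar_mat_def)
  also have "\<dots> = (\<Prod>a \<leftarrow> diag_mat ?D. [:- a, 1:])"
    by (rule char_poly_upper_triangular[of _ n]) (auto simp: mat_diag_def)
  finally have "spectrum (unitary_diag n U d) = set (diag_mat ?D)"
    using spectrum_root_char_poly[OF unitary_diag_carrier[OF U(1)]]
    by (auto simp: poly_prod_list prod_list_zero_iff)
  also have "\<dots> = complex_of_real ` d ` {..<n}"
    by (auto simp: diag_mat_def mat_diag_def)
  finally show ?thesis .
qed

lemma eigenvalues_in_unitary_diag: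
  assumes "U \<in> carrier_mat n n" "unitary_mat U"
  shows "eigenvalues_in (unitary_diag n U d) I \<longleftrightarrow> (\<forall>i<n. d i \<in> I)"
  unfolding eigenvalues_in_def spectrum_unitary_diag[OF assms] by (auto simp: image_subset_iff image_iff)

section \<open>The Loewner order through quadratic forms\<close>

lemma qform_minus:
  assumes "A \<in> carrier_mat n n" "B \<in> carrier_mat n n" "v \<in> carrier_vec n"
  shows "qform (B - A) v = qform B v - qform A v"
  using assms by (simp add: qform_def minus_mult_distrib_mat_vec[of _ n n]
      minus_scalar_prod_distrib[of _ n] mult_mat_vec_carrier[of _ n n])

lemma qform_add:
  assumes "A \<in> carrier_mat n n" "B \<in> carrier_mat n n" "v \<in> carrier_vec n"
  shows "qform (A + B) v = qform A v + qform B v"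
  using assms by (simp add: qform_def add_mult_distrib_mat_vec[of _ n n]
      add_scalar_prod_distrib[of _ n] mult_mat_vec_carrier[of _ n n])

lemma qform_smult:
  assumes "A \<in> carrier_mat n n" "v \<in> carrier_vec n"
  shows "qform (complex_of_real c \<cdot>\<^sub>m A) v = c * qform A v"
proof -
  have "(complex_of_real c \<cdot>\<^sub>m A) *\<^sub>v v = complex_of_real c \<cdot>\<^sub>v (A *\<^sub>v v)"
    using assms by (intro eq_vecI) auto
  then show ?thesis
    using assms by (simp add: qform_def mult_mat_vec_carrier[of _ n n])
qed

lemma loewner_leD:
  assumes "loewner_le A B" "A \<in> carrier_mat n n" "B \<in> carrier_mat n n" "v \<in> carrier_vec n"
  shows "qform A v \<le> qform B v"
  using assms qform_minus[OF assms(2-4)]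
  by (auto simp: loewner_le_def positive_mat_def qform_def)

lemma loewner_leI:
  assumes A: "A \<in> carrier_mat n n" "selfadjoint_mat A" and B: "B \<in> carrier_mat n n" "selfadjoint_mat B"
    and "\<And>v. v \<in> carrier_vec n \<Longrightarrow> qform A v \<le> qform B v"
  shows "loewner_le A B"
proof -
  have "selfadjoint_mat (B - A)"
    using A B by (intro selfadjoint_matI[of _ n]) (auto simp: mat_adjoint_minus[of _ n n] selfadjoint_matD)
  then show ?thesis
    using assms qform_minus[OF A(1) B(1)]
    by (auto simp: loewner_le_def positive_mat_def qform_def)
qed

text \<open>By Parseval the weights \<open>p i\<close> sum to 1, so the form at a unit vector is a
  convex combination of the eigenvalues and lies between the least and the greatest of them.\<close>

lemma qform_unit_bounds:
  assumes U: "U \<in> carrier_mat n n" "unitary_mat U" and v: "v \<in> carrier_vec n"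
    and unit: "(\<Sum>i<n. (cmod (v $ i))\<^sup>2) = 1"
  obtains i j where "i < n" "j < n"
    "d i \<le> qform (unitary_diag n U d) v" "qform (unitary_diag n U d) v \<le> d j"
proof -
  define p where "p = (\<lambda>i. (cmod ((mat_adjoint U *\<^sub>v v) $ i))\<^sup>2)"
  have p: "(\<Sum>i<n. p i) = 1" using unitary_sum_cmod[OF U v] unit by (simp add: p_def)
  have q: "qform (unitary_diag n U d) v = (\<Sum>i<n. d i * p i)"
    unfolding p_def by (rule qform_unitary_diag[OF U(1) v])
  have p0: "p i \<ge> 0" for i by (simp add: p_def)
  from unit have "n \<noteq> 0" by (intro notI) simp
  then have ne: "d ` {..<n} \<noteq> {}" "finite (d ` {..<n})" by (auto simp: lessThan_empty_iff)
  obtain i where i: "i < n" "d i = Min (d ` {..<n})" using Min_in[OF ne(2,1)] by auto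
  obtain j where j: "j < n" "d j = Max (d ` {..<n})" using Max_in[OF ne(2,1)] by auto
  have "(\<Sum>k<n. d i * p k) \<le> (\<Sum>k<n. d k * p k)"
    using ne i p0 by (intro sum_mono mult_right_mono) auto
  moreover have "(\<Sum>k<n. d k * p k) \<le> (\<Sum>k<n. d j * p k)"
    using ne j p0 by (intro sum_mono mult_right_mono) auto
  ultimately show ?thesis
    using that[OF i(1) j(1)] q p by (simp flip: sum_distrib_left)
qed

text \<open>Evaluate all three forms at a unit eigenvector of \<open>c\<close>. The form of
  \<open>c\<close> gives its eigenvalue, the form of \<open>a\<close> is at least some eigenvalue of
  \<open>a\<close>, and the form of \<open>b\<close> is at most some eigenvalue of \<open>b\<close>;
  order convexity of \<open>I\<close> does the rest.\<close>

lemma eigenvalues_in_between: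
  assumes I: "\<And>x y z. x \<in> I \<Longrightarrow> z \<in> I \<Longrightarrow> x \<le> y \<Longrightarrow> y \<le> z \<Longrightarrow> y \<in> I"
    and a: "a \<in> carrier_mat n n" "selfadjoint_mat a" "eigenvalues_in a I"
    and b: "b \<in> carrier_mat n n" "selfadjoint_mat b" "eigenvalues_in b I"
    and c: "c \<in> carrier_mat n n" "selfadjoint_mat c"
    and le: "\<And>v. v \<in> carrier_vec n \<Longrightarrow> qform a v \<le> qform c v"
      "\<And>v. v \<in> carrier_vec n \<Longrightarrow> qform c v \<le> qform b v"
  shows "eigenvalues_in c I"
proof -
  obtain U d where U: "U \<in> carrier_mat n n" "unitary_mat U" and ad: "a = unitary_diag n U d"
    using spectral_decomposition[OF a(1,2)] .
  obtain V e where V: "V \<in> carrier_mat n n" "unitary_mat V" and be: "b = unitary_diag n V e"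
    using spectral_decomposition[OF b(1,2)] .
  obtain W g where W: "W \<in> carrier_mat n n" "unitary_mat W" and cg: "c = unitary_diag n W g"
    using spectral_decomposition[OF c] .
  have dI: "\<forall>i<n. d i \<in> I" using a(3) eigenvalues_in_unitary_diag[OF U] by (simp add: ad)
  have eI: "\<forall>i<n. e i \<in> I" using b(3) eigenvalues_in_unitary_diag[OF V] by (simp add: be)
  have "g k \<in> I" if k: "k < n" for k
  proof -
    define v where "v = col W k"
    have v: "v \<in> carrier_vec n" using W k by (simp add: v_def)
    note Wv = unitary_adjoint_mult_col[OF W k, folded v_def]
    have unit: "(\<Sum>i<n. (cmod (v $ i))\<^sup>2) = 1"
      using k unfolding unitary_sum_cmod[OF W v, symmetric] Wv
      by (simp add: unit_vec_def if_distrib[of cmod] if_distrib[of "\<lambda>x. x\<^sup>2"] sum.delta cong: if_cong)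
    have gk: "qform c v = g k" unfolding cg v_def by (rule qform_unitary_diag_col[OF W k])
    obtain i where i: "i < n" "d i \<le> qform a v"
      using qform_unit_bounds[OF U v unit] unfolding ad by blast
    obtain j where j: "j < n" "qform b v \<le> e j"
      using qform_unit_bounds[OF V v unit] unfolding be by blast
    show ?thesis
      using I[of "d i" "e j" "g k"] dI eI i j gk le[OF v] by auto
  qed
  then show ?thesis unfolding cg eigenvalues_in_unitary_diag[OF W] by blast
qed

section \<open>Diagonalising the dilation T^* T of a rank one perturbation\<close>

lemma mat_adjoint_mult_self_column:
  fixes y :: "complex mat"
  assumes "y \<in> carrier_mat m 1"
  shows "mat_adjoint y * y = complex_of_real (\<Sum>i<m. (cmod (y $$ (i, 0)))\<^sup>2) \<cdot>\<^sub>m 1\<^sub>m 1"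
proof -
  have "(mat_adjoint y * y) $$ (0, 0) = (\<Sum>i<m. cnj (y $$ (i, 0)) * y $$ (i, 0))"
    using assms by (simp add: scalar_prod_def atLeast0LessThan)
  also have "\<dots> = complex_of_real (\<Sum>i<m. (cmod (y $$ (i, 0)))\<^sup>2)"
    unfolding of_real_sum by (intro sum.cong refl) (metis complex_norm_square mult.commute)
  finally show ?thesis using assms by (intro eq_matI) auto
qed

text \<open>Put T = (\<open>S\<close>, \<open>x\<close>), so that T T^* is diagonalised by
  \<open>V\<close> with eigenvalues \<open>\<mu>\<close>. The vectors T^* v_i / sqrt
  (\<open>\<mu> i\<close>), with v_i the columns of \<open>V\<close>, are orthonormal eigenvectors
  of T^* T for the same eigenvalues, and the kernel of T supplies one more for 0. The last
  conclusion turns coordinates with respect to \<open>U\<close> into coordinates with respect to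
  \<open>V\<close>.\<close>

lemma rank_one_dilation:
  assumes S: "S \<in> carrier_mat m m" and R: "R \<in> carrier_mat m m" and SR: "S * R = 1\<^sub>m m"
    and x: "x \<in> carrier_mat m 1" and V: "V \<in> carrier_mat m m" "unitary_mat V"
    and eq: "S * mat_adjoint S + x * mat_adjoint x = unitary_diag m V \<mu>"
    and \<mu>: "\<And>i. i < m \<Longrightarrow> \<mu> i > 0"
  obtains U where "U \<in> carrier_mat (m + 1) (m + 1)" "unitary_mat U"
    "unitary_diag (m + 1) U (\<lambda>i. if i < m then \<mu> i else 0) =
      four_block_mat (mat_adjoint S * S) (mat_adjoint S * x) (mat_adjoint x * S) (mat_adjoint x * x)"
    "\<And>w i. w \<in> carrier_vec m \<Longrightarrow> i < m \<Longrightarrow>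
      (mat_adjoint U *\<^sub>v (w @\<^sub>v 0\<^sub>v 1)) $ i = (mat_adjoint V *\<^sub>v (S *\<^sub>v w)) $ i / complex_of_real (sqrt (\<mu> i))"
proof -
  define E where "E = real_diag m (\<lambda>i. 1 / sqrt (\<mu> i))"
  define M where "M = real_diag m \<mu>"
  define Z where "Z = V * E"
  \<comment> \<open>Since \<open>R\<close> inverts \<open>S\<close>, this solves
    \<open>S * y = x\<close>; hence (-\<open>y\<close>, 1) spans the kernel of T, and
    \<open>c\<close> scales it to length 1.\<close>
  define y where "y = R * x"
  define s where "s = (\<Sum>i<m. (cmod (y $$ (i, 0)))\<^sup>2)"
  define c where "c = complex_of_real (1 / sqrt (1 + s))"
  define q where "q = - (c \<cdot>\<^sub>m y)"
  \<comment> \<open>The left blocks are T^* \<open>Z\<close>, the normalised eigenvectors for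
    \<open>\<mu>\<close>; the right blocks are the unit kernel vector.\<close>
  define U where "U = four_block_mat (mat_adjoint S * Z) q (mat_adjoint x * Z) (c \<cdot>\<^sub>m 1\<^sub>m 1)"
  have E: "E \<in> carrier_mat m m" and M: "M \<in> carrier_mat m m" by (simp_all add: E_def M_def)
  have Z: "Z \<in> carrier_mat m m" using V E by (simp add: Z_def)
  have y: "y \<in> carrier_mat m 1" using R x by (simp add: y_def)
  have q: "q \<in> carrier_mat m 1" using y by (simp add: q_def)
  note dims = carrier_matD[OF S] carrier_matD[OF R] carrier_matD[OF x] carrier_matD[OF V(1)]
    carrier_matD[OF E] carrier_matD[OF M] carrier_matD[OF Z] carrier_matD[OF y] carrier_matD[OF q]
  note adj = mat_adjoint_carrier[OF S] mat_adjoint_carrier[OF x] mat_adjoint_carrier[OF V(1)]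
    mat_adjoint_carrier[OF Z] mat_adjoint_carrier[OF y] mat_adjoint_carrier[OF q]
  have EE: "mat_adjoint E = E" unfolding E_def by (rule mat_adjoint_diag_real)
  have EME: "E * (M * E) = 1\<^sub>m m"
    unfolding E_def M_def mat_diag_diag mat_diag_one[symmetric]
    by (rule mat_diag_cong, drule \<mu>) (simp flip: of_real_mult)
  have Za: "mat_adjoint Z = E * mat_adjoint V"
    unfolding Z_def using EE by (simp add: mat_adjoint_mult dims)
  have VV: "mat_adjoint V * V = 1\<^sub>m m" "V * mat_adjoint V = 1\<^sub>m m"
    using unitary_matD[OF V] by auto
  \<comment> \<open>This identity reduces the product with \<open>U\<close> and its adjoint to T^*
    T, whereas \<open>ZbZ\<close> below says that the columns of T^* \<open>Z\<close> are
    orthonormal.\<close>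
  have ZMZ: "Z * (M * mat_adjoint Z) = 1\<^sub>m m"
  proof -
    have "Z * (M * mat_adjoint Z) = V * ((E * (M * E)) * mat_adjoint V)"
      unfolding Za unfolding Z_def by (simp add: mat_mult_assoc dims)
    then show ?thesis using EME VV by (simp add: dims)
  qed
  have ZbZ: "mat_adjoint Z * ((S * mat_adjoint S + x * mat_adjoint x) * Z) = 1\<^sub>m m"
  proof -
    have "mat_adjoint Z * (unitary_diag m V \<mu> * Z) = E * ((mat_adjoint V * V) * (M * ((mat_adjoint V * V) * E)))"
      unfolding Za unfolding Z_def unitary_diag_def M_def[symmetric] by (simp add: mat_mult_assoc dims)
    then show ?thesis using EME VV eq by (simp add: dims)
  qed
  have Sy: "S * y = x"
  proof -
    have "S * y = (S * R) * x" unfolding y_def by (simp add: mat_mult_assoc dims)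
    then show ?thesis using SR by (simp add: dims)
  qed
  have yy: "mat_adjoint y * y = complex_of_real s \<cdot>\<^sub>m 1\<^sub>m 1" and s: "s \<ge> 0"
    unfolding s_def by (rule mat_adjoint_mult_self_column[OF y]) (simp add: sum_nonneg)
  have cs: "c * c * (1 + complex_of_real s) = 1"
  proof -
    have "1 / sqrt (1 + s) * (1 / sqrt (1 + s)) * (1 + s) = 1" using s by simp
    then show ?thesis unfolding c_def by (metis of_real_1 of_real_add of_real_mult)
  qed
  have cc: "cnj c = c" by (simp add: c_def)
  have qa: "mat_adjoint q = - (c \<cdot>\<^sub>m mat_adjoint y)"
    using y cc by (intro eq_matI) (auto simp: q_def)
  have U: "U \<in> carrier_mat (m + 1) (m + 1)"
    unfolding U_def using adj Z by (intro four_block_carrier_mat) auto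
  have Ua: "mat_adjoint U = four_block_mat (mat_adjoint Z * S) (mat_adjoint Z * x) (mat_adjoint q) (c \<cdot>\<^sub>m 1\<^sub>m 1)"
    unfolding U_def using adj Z S x q cc
    by (subst mat_adjoint_four_block[of _ m m _ 1 _ 1])
      (auto simp: mat_adjoint_mult mat_adjoint_smult dims)
  have TL: "mat_adjoint Z * S * (mat_adjoint S * Z) + mat_adjoint Z * x * (mat_adjoint x * Z) = 1\<^sub>m m"
  proof -
    have "mat_adjoint Z * S * (mat_adjoint S * Z) + mat_adjoint Z * x * (mat_adjoint x * Z)
        = mat_adjoint Z * ((S * mat_adjoint S) * Z) + mat_adjoint Z * ((x * mat_adjoint x) * Z)"
      by (simp add: mat_mult_assoc dims)
    also have "\<dots> = mat_adjoint Z * ((S * mat_adjoint S) * Z + (x * mat_adjoint x) * Z)"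
      using S x Z adj by (intro mult_add_distrib_mat[symmetric, of _ m m _ m]) auto
    also have "(S * mat_adjoint S) * Z + (x * mat_adjoint x) * Z = (S * mat_adjoint S + x * mat_adjoint x) * Z"
      using S x Z adj by (intro add_mult_distrib_mat[symmetric, of _ m m]) auto
    finally show ?thesis using ZbZ by simp
  qed
  have Sq: "S * q = - (c \<cdot>\<^sub>m x)"
    using Sy unfolding q_def by (simp add: mat_mult_smult dims)
  \<comment> \<open>The columns of T^* \<open>Z\<close> are orthogonal to the last column because T
    annihilates it, that is, \<open>S * q\<close> cancels \<open>c\<close> times \<open>x\<close>.
    The block \<open>BL\<close> is the adjoint of this one.\<close>
  have TR: "mat_adjoint Z * S * q + mat_adjoint Z * x * (c \<cdot>\<^sub>m 1\<^sub>m 1) = 0\<^sub>m m 1"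
  proof -
    have "mat_adjoint Z * S * q = mat_adjoint Z * (- (c \<cdot>\<^sub>m x))"
      unfolding Sq[symmetric] by (simp add: mat_mult_assoc dims)
    also have "\<dots> = - (c \<cdot>\<^sub>m (mat_adjoint Z * x))"
      by (simp add: mat_mult_smult dims)
    finally show ?thesis
      by (intro eq_matI) (auto simp: mat_mult_smult dims simp del: index_mult_mat(1))
  qed
  have BL: "mat_adjoint q * (mat_adjoint S * Z) + c \<cdot>\<^sub>m 1\<^sub>m 1 * (mat_adjoint x * Z) = 0\<^sub>m 1 m"
  proof -
    have "mat_adjoint (mat_adjoint Z * S * q + mat_adjoint Z * x * (c \<cdot>\<^sub>m 1\<^sub>m 1)) =
      mat_adjoint (mat_adjoint Z * S * q) + mat_adjoint (mat_adjoint Z * x * (c \<cdot>\<^sub>m 1\<^sub>m 1))"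
      by (intro mat_adjoint_add[of _ m 1] carrier_matI) (simp_all add: dims)
    also have "mat_adjoint (mat_adjoint Z * S * q) = mat_adjoint q * (mat_adjoint S * Z)"
      by (simp add: mat_adjoint_mult dims)
    also have "mat_adjoint (mat_adjoint Z * x * (c \<cdot>\<^sub>m 1\<^sub>m 1)) = c \<cdot>\<^sub>m 1\<^sub>m 1 * (mat_adjoint x * Z)"
      using cc by (simp add: mat_adjoint_mult mat_adjoint_smult dims)
    finally show ?thesis unfolding TR by simp
  qed
  have BR: "mat_adjoint q * q + c \<cdot>\<^sub>m 1\<^sub>m 1 * (c \<cdot>\<^sub>m 1\<^sub>m 1) = 1\<^sub>m 1"
  proof -
    have "mat_adjoint q * q = (c * c) \<cdot>\<^sub>m (mat_adjoint y * y)"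
      unfolding qa unfolding q_def 
      by (intro eq_matI) (auto simp: mat_mult_smult dims simp del: index_mult_mat(1))
    then show ?thesis unfolding yy using cs
      by (intro eq_matI) (simp_all add: scalar_prod_def algebra_simps)
  qed
  have "mat_adjoint U * U = four_block_mat
      (mat_adjoint Z * S * (mat_adjoint S * Z) + mat_adjoint Z * x * (mat_adjoint x * Z))
      (mat_adjoint Z * S * q + mat_adjoint Z * x * (c \<cdot>\<^sub>m 1\<^sub>m 1))
      (mat_adjoint q * (mat_adjoint S * Z) + c \<cdot>\<^sub>m 1\<^sub>m 1 * (mat_adjoint x * Z))
      (mat_adjoint q * q + c \<cdot>\<^sub>m 1\<^sub>m 1 * (c \<cdot>\<^sub>m 1\<^sub>m 1))"
    unfolding Ua unfolding U_def
    by (rule mult_four_block_mat[of _ m m _ 1 _ 1 _ _ m _ 1]; intro carrier_matI; simp add: dims)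
  then have "mat_adjoint U * U = 1\<^sub>m (m + 1)"
    unfolding TL TR BL BR by simp
  then have uU: "unitary_mat U" by (rule unitary_matI[OF U])
  have diag: "real_diag (m + 1) (\<lambda>i. if i < m then \<mu> i else 0) = four_block_mat M (0\<^sub>m m 1) (0\<^sub>m 1 m) (0\<^sub>m 1 1)"
    unfolding M_def by (intro eq_matI) (auto simp: mat_diag_def)
  have "U * real_diag (m + 1) (\<lambda>i. if i < m then \<mu> i else 0) = four_block_mat
      (mat_adjoint S * Z * M + q * 0\<^sub>m 1 m) (mat_adjoint S * Z * 0\<^sub>m m 1 + q * 0\<^sub>m 1 1)
      (mat_adjoint x * Z * M + c \<cdot>\<^sub>m 1\<^sub>m 1 * 0\<^sub>m 1 m) (mat_adjoint x * Z * 0\<^sub>m m 1 + c \<cdot>\<^sub>m 1\<^sub>m 1 * 0\<^sub>m 1 1)"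
    unfolding diag U_def
    by (rule mult_four_block_mat[of _ m m _ 1 _ 1 _ _ m _ 1]; intro carrier_matI; simp add: dims)
  also have "\<dots> = four_block_mat (mat_adjoint S * Z * M) (0\<^sub>m m 1) (mat_adjoint x * Z * M) (0\<^sub>m 1 1)"
    by (rule cong_four_block_mat; simp add: dims mat_add_zero)
  finally have "U * real_diag (m + 1) (\<lambda>i. if i < m then \<mu> i else 0) =
      four_block_mat (mat_adjoint S * Z * M) (0\<^sub>m m 1) (mat_adjoint x * Z * M) (0\<^sub>m 1 1)" .
  then have "unitary_diag (m + 1) U (\<lambda>i. if i < m then \<mu> i else 0) =
      four_block_mat (mat_adjoint S * Z * M) (0\<^sub>m m 1) (mat_adjoint x * Z * M) (0\<^sub>m 1 1) * mat_adjoint U"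
    unfolding unitary_diag_def by simp
  also have "\<dots> = four_block_mat
     (mat_adjoint S * Z * M * (mat_adjoint Z * S) + 0\<^sub>m m 1 * mat_adjoint q)
     (mat_adjoint S * Z * M * (mat_adjoint Z * x) + 0\<^sub>m m 1 * (c \<cdot>\<^sub>m 1\<^sub>m 1))
     (mat_adjoint x * Z * M * (mat_adjoint Z * S) + 0\<^sub>m 1 1 * mat_adjoint q)
     (mat_adjoint x * Z * M * (mat_adjoint Z * x) + 0\<^sub>m 1 1 * (c \<cdot>\<^sub>m 1\<^sub>m 1))"
    unfolding Ua
    by (rule mult_four_block_mat[of _ m m _ 1 _ 1 _ _ m _ 1]; intro carrier_matI; simp add: dims)
  \<comment> \<open>The eigenvalue 0 has removed the kernel vector; in each remaining block the
    middle factor is the identity by \<open>ZMZ\<close>.\<close>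
  also have "\<dots> = four_block_mat (mat_adjoint S * S) (mat_adjoint S * x) (mat_adjoint x * S) (mat_adjoint x * x)"
  proof -
    have "P * Z * M * (mat_adjoint Z * T) = P * T"
      if "dim_col P = m" "dim_row T = m" for P T :: "complex mat"
    proof -
      have "P * Z * M * (mat_adjoint Z * T) = P * ((Z * (M * mat_adjoint Z)) * T)"
        using that by (simp add: mat_mult_assoc dims)
      then show ?thesis unfolding ZMZ using that by (simp add: left_mult_one_mat[of T m "dim_col T"])
    qed
    then show ?thesis by (intro cong_four_block_mat; simp add: dims mat_add_zero)
  qed
  finally have UD: "unitary_diag (m + 1) U (\<lambda>i. if i < m then \<mu> i else 0) =
      four_block_mat (mat_adjoint S * S) (mat_adjoint S * x) (mat_adjoint x * S) (mat_adjoint x * x)" .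
  \<comment> \<open>On a vector with last coordinate 0 only the block
    \<open>mat_adjoint Z * S\<close> contributes to the first \<open>m\<close> coordinates, and the
    factor \<open>E\<close> in \<open>mat_adjoint Z\<close> divides by the square roots.\<close>
  have Uw: "(mat_adjoint U *\<^sub>v (w @\<^sub>v 0\<^sub>v 1)) $ i = (mat_adjoint V *\<^sub>v (S *\<^sub>v w)) $ i / complex_of_real (sqrt (\<mu> i))"
    if w: "w \<in> carrier_vec m" and i: "i < m" for w i
  proof -
    have "mat_adjoint U *\<^sub>v (w @\<^sub>v 0\<^sub>v 1) = ((mat_adjoint Z * S) *\<^sub>v w + (mat_adjoint Z * x) *\<^sub>v 0\<^sub>v 1) @\<^sub>v
        (mat_adjoint q *\<^sub>v w + (c \<cdot>\<^sub>m 1\<^sub>m 1) *\<^sub>v 0\<^sub>v 1)"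
      unfolding Ua by (rule four_block_mat_mult_vec[of _ m m _ 1 _ 1]) (use S x w adj in auto)
    then have "(mat_adjoint U *\<^sub>v (w @\<^sub>v 0\<^sub>v 1)) $ i = ((mat_adjoint Z * S) *\<^sub>v w + (mat_adjoint Z * x) *\<^sub>v 0\<^sub>v 1) $ i"
      using i by (simp add: dims del: index_mult_mat_vec)
    also have "(mat_adjoint Z * x) *\<^sub>v 0\<^sub>v 1 = 0\<^sub>v m"
      by (intro eq_vecI) (simp_all add: scalar_prod_def dims)
    also have "(mat_adjoint Z * S) *\<^sub>v w + 0\<^sub>v m = (mat_adjoint Z * S) *\<^sub>v w"
      using adj S w by (intro right_zero_vec mult_mat_vec_carrier[of _ m m]) auto
    also have "(mat_adjoint Z * S) *\<^sub>v w = E *\<^sub>v (mat_adjoint V *\<^sub>v (S *\<^sub>v w))"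
      unfolding Za using E adj S w
      by (simp add: assoc_mult_mat_vec[of _ m m _ m] mult_carrier_mat[of _ m m _ m] mult_mat_vec_carrier[of _ m m])
    also have "\<dots> $ i = (mat_adjoint V *\<^sub>v (S *\<^sub>v w)) $ i / complex_of_real (sqrt (\<mu> i))"
      unfolding E_def using adj S w i
      by (simp add: mat_diag_mult_vec mult_mat_vec_carrier[of _ m m] del: index_mult_mat_vec)
    finally show ?thesis .
  qed
  show ?thesis by (rule that[OF U uU UD Uw])
qed

section \<open>Convexity applied to a rank one increase\<close>

lemma matrix_convexD:
  assumes "matrix_convex m I f" "a \<in> carrier_mat m m" "b \<in> carrier_mat m m"
    "selfadjoint_mat a" "selfadjoint_mat b" "eigenvalues_in a I" "eigenvalues_in b I" "0 \<le> l" "l \<le> 1"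
  shows "loewner_le (fun_calc f (complex_of_real l \<cdot>\<^sub>m a + complex_of_real (1 - l) \<cdot>\<^sub>m b))
    (complex_of_real l \<cdot>\<^sub>m fun_calc f a + complex_of_real (1 - l) \<cdot>\<^sub>m fun_calc f b)"
  using assms unfolding matrix_convex_def by (meson atLeastAtMost_iff)

text \<open>Midpoint convexity is applied to the dilations built from \<open>x\<close> and from
  \<open>- x\<close>, and tested on the vector \<open>u\<close> supported in the upper left block.
  On both sides, rewriting coordinates divides each weight by the eigenvalue, which turns
  \<open>f t\<close> into \<open>f t / t\<close>.\<close>

lemma matrix_convex_rank_one_step:
  assumes conv: "matrix_convex (m + 1) J f" and J0: "0 \<in> J" and f0: "f 0 \<le> 0"
    and W: "W \<in> carrier_mat m m" "unitary_mat W" and lam: "\<And>i. i < m \<Longrightarrow> lam i > 0"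
    and V: "V \<in> carrier_mat m m" "unitary_mat V" and \<mu>: "\<And>i. i < m \<Longrightarrow> \<mu> i > 0"
    and \<mu>J: "\<And>i. i < m \<Longrightarrow> \<mu> i \<in> J"
    and x: "x \<in> carrier_mat m 1"
    and eq: "unitary_diag m W lam + x * mat_adjoint x = unitary_diag m V \<mu>"
    and v: "v \<in> carrier_vec m"
  shows "qform (unitary_diag m W (\<lambda>i. f (lam i) / lam i)) v \<le> qform (unitary_diag m V (\<lambda>i. f (\<mu> i) / \<mu> i)) v"
proof -
  define D where "D = real_diag m (\<lambda>i. sqrt (lam i))"
  define D' where "D' = real_diag m (\<lambda>i. 1 / sqrt (lam i))"
  \<comment> \<open>A factor of the smaller matrix \<open>unitary_diag m W lam\<close>, with
    explicit inverse \<open>R\<close>; the opposite product \<open>mat_adjoint S * S\<close> is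
    already diagonal.\<close>
  define S where "S = W * D"
  define R where "R = D' * mat_adjoint W"
  have D: "D \<in> carrier_mat m m" and D': "D' \<in> carrier_mat m m" by (simp_all add: D_def D'_def)
  note Wa = mat_adjoint_carrier[OF W(1)]
  have S: "S \<in> carrier_mat m m" using W D by (simp add: S_def)
  have R: "R \<in> carrier_mat m m" using Wa D' by (simp add: R_def)
  note Sa = mat_adjoint_carrier[OF S] and xa = mat_adjoint_carrier[OF x]
  note dims = carrier_matD[OF W(1)] carrier_matD[OF D] carrier_matD[OF D'] carrier_matD[OF x]
    carrier_matD[OF S] carrier_matD[OF R]
  have WW: "mat_adjoint W * W = 1\<^sub>m m" "W * mat_adjoint W = 1\<^sub>m m"
    using unitary_matD[OF W] by auto
  have "D * D' = mat_diag m (\<lambda>_. 1)" and DD1: "D * D = real_diag m lam"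
    unfolding D_def D'_def mat_diag_diag
    by (rule mat_diag_cong, drule lam, simp flip: of_real_mult)+
  then have DD: "D * D' = 1\<^sub>m m" "D * D = real_diag m lam" "mat_adjoint D = D"
    unfolding D_def by (simp_all only: mat_diag_one mat_adjoint_diag_real)
  have Sadj: "mat_adjoint S = D * mat_adjoint W"
    unfolding S_def using DD by (simp add: mat_adjoint_mult dims)
  have SR: "S * R = 1\<^sub>m m"
  proof -
    have "S * R = W * ((D * D') * mat_adjoint W)"
      unfolding S_def R_def by (simp add: mat_mult_assoc dims)
    then show ?thesis using DD WW by (simp add: dims)
  qed
  have SS: "S * mat_adjoint S = unitary_diag m W lam"
    unfolding Sadj unfolding S_def unitary_diag_def DD(2)[symmetric] by (simp add: mat_mult_assoc dims)
  have SS': "mat_adjoint S * S = real_diag m lam"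
  proof -
    have "mat_adjoint S * S = D * ((mat_adjoint W * W) * D)"
      unfolding Sadj unfolding S_def by (simp add: mat_mult_assoc dims)
    then show ?thesis using DD WW by (simp add: dims)
  qed
  \<comment> \<open>Eigenvalues of either dilation: those of the larger matrix and, at index
    \<open>m\<close>, the extra 0, which lies in \<open>J\<close> by \<open>J0\<close>.\<close>
  define \<nu> where "\<nu> = (\<lambda>i. if i < m then \<mu> i else 0)"
  have \<nu>J: "\<forall>i<m + 1. \<nu> i \<in> J" using \<mu>J J0 by (simp add: \<nu>_def)
  \<comment> \<open>Chosen so that \<open>S *\<^sub>v w = v\<close>.\<close>
  define w where "w = R *\<^sub>v v"
  have w: "w \<in> carrier_vec m" using R v by (simp add: w_def)
  have Sw: "S *\<^sub>v w = v"
    using SR S R v by (simp add: w_def flip: assoc_mult_mat_vec[of _ m m _ m])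
  define u where "u = w @\<^sub>v 0\<^sub>v 1"
  have u: "u \<in> carrier_vec (m + 1)" unfolding u_def by (rule append_carrier_vec[OF w zero_carrier_vec])
  \<comment> \<open>Only \<open>z * mat_adjoint z\<close> enters the perturbed matrix, so this form
    of the claim covers both \<open>x\<close> and \<open>- x\<close>.\<close>
  have dilation: "\<exists>U \<in> carrier_mat (m + 1) (m + 1). unitary_mat U \<and>
      unitary_diag (m + 1) U \<nu> = four_block_mat (real_diag m lam) (mat_adjoint S * z) (mat_adjoint z * S) (mat_adjoint z * z) \<and>
      qform (unitary_diag (m + 1) U (\<lambda>i. f (\<nu> i))) u \<le> qform (unitary_diag m V (\<lambda>i. f (\<mu> i) / \<mu> i)) v"
    if z: "z \<in> carrier_mat m 1" and zz: "z * mat_adjoint z = x * mat_adjoint x" for z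
  proof -
    have eq': "S * mat_adjoint S + z * mat_adjoint z = unitary_diag m V \<mu>"
      using eq SS zz by simp
    obtain U where U: "U \<in> carrier_mat (m + 1) (m + 1)" "unitary_mat U"
      and UD: "unitary_diag (m + 1) U \<nu> =
        four_block_mat (mat_adjoint S * S) (mat_adjoint S * z) (mat_adjoint z * S) (mat_adjoint z * z)"
      and Uw: "\<And>w i. w \<in> carrier_vec m \<Longrightarrow> i < m \<Longrightarrow>
      (mat_adjoint U *\<^sub>v (w @\<^sub>v 0\<^sub>v 1)) $ i = (mat_adjoint V *\<^sub>v (S *\<^sub>v w)) $ i / complex_of_real (sqrt (\<mu> i))"
      using rank_one_dilation[OF S R SR z V eq' \<mu>] unfolding \<nu>_def by blast
    have "qform (unitary_diag (m + 1) U (\<lambda>i. f (\<nu> i))) u =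
      (\<Sum>i<m. f (\<mu> i) * (cmod ((mat_adjoint U *\<^sub>v u) $ i))\<^sup>2) + f 0 * (cmod ((mat_adjoint U *\<^sub>v u) $ m))\<^sup>2"
      unfolding qform_unitary_diag[OF U(1) u] by (simp add: \<nu>_def)
    \<comment> \<open>The kernel direction contributes \<open>f 0\<close> times a square, which is
      at most 0.\<close>
    also have "\<dots> \<le> (\<Sum>i<m. f (\<mu> i) * (cmod ((mat_adjoint U *\<^sub>v u) $ i))\<^sup>2)"
      using f0 by (simp add: mult_nonpos_nonneg)
    also have "\<dots> = (\<Sum>i<m. f (\<mu> i) / \<mu> i * (cmod ((mat_adjoint V *\<^sub>v v) $ i))\<^sup>2)"
    proof (rule sum.cong)
      fix i assume "i \<in> {..<m}"
      then have i: "i < m" by simp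
      show "f (\<mu> i) * (cmod ((mat_adjoint U *\<^sub>v u) $ i))\<^sup>2 = f (\<mu> i) / \<mu> i * (cmod ((mat_adjoint V *\<^sub>v v) $ i))\<^sup>2"
        unfolding u_def Uw[OF w i] Sw using \<mu>[OF i]
        by (simp add: norm_divide power_divide del: index_mult_mat_vec)
    qed simp
    also have "\<dots> = qform (unitary_diag m V (\<lambda>i. f (\<mu> i) / \<mu> i)) v"
      by (rule qform_unitary_diag[OF V(1) v, symmetric])
    finally show ?thesis using U UD SS' by auto
  qed
  obtain P where P: "P \<in> carrier_mat (m + 1) (m + 1)" "unitary_mat P"
    and PD: "unitary_diag (m + 1) P \<nu> = four_block_mat (real_diag m lam) (mat_adjoint S * x) (mat_adjoint x * S) (mat_adjoint x * x)"
    and Pq: "qform (unitary_diag (m + 1) P (\<lambda>i. f (\<nu> i))) u \<le> qform (unitary_diag m V (\<lambda>i. f (\<mu> i) / \<mu> i)) v"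
    using dilation[OF x] by auto
  have xm: "mat_adjoint (- x) = - mat_adjoint x" by (intro eq_matI) auto
  have "- x * mat_adjoint (- x) = x * mat_adjoint x"
    unfolding xm using x xa by simp
  then obtain Q where Q: "Q \<in> carrier_mat (m + 1) (m + 1)" "unitary_mat Q"
    and QD: "unitary_diag (m + 1) Q \<nu> = four_block_mat (real_diag m lam) (mat_adjoint S * (- x)) (mat_adjoint (- x) * S) (mat_adjoint (- x) * (- x))"
    and Qq: "qform (unitary_diag (m + 1) Q (\<lambda>i. f (\<nu> i))) u \<le> qform (unitary_diag m V (\<lambda>i. f (\<mu> i) / \<mu> i)) v"
    using dilation[of "- x"] x by auto
  let ?h = "complex_of_real (1 / 2)"
  let ?avg = "?h \<cdot>\<^sub>m unitary_diag (m + 1) P \<nu> + complex_of_real (1 - 1 / 2) \<cdot>\<^sub>m unitary_diag (m + 1) Q \<nu>"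
  define t where "t = (\<Sum>i<m. (cmod (x $$ (i, 0)))\<^sup>2)"
  \<comment> \<open>The diagonal of the average: the diagonal blocks of the two dilations agree,
    with last entry the squared norm of \<open>x\<close>, while the off-diagonal blocks have
    opposite signs and cancel.\<close>
  define \<kappa> where "\<kappa> = (\<lambda>i. if i < m then lam i else t)"
  have xx: "(mat_adjoint x * x) $$ (0, 0) = complex_of_real t"
    unfolding mat_adjoint_mult_self_column[OF x] t_def by simp
  have I: "1\<^sub>m (m + 1) \<in> carrier_mat (m + 1) (m + 1)" "unitary_mat (1\<^sub>m (m + 1))"
    by (auto intro!: unitary_matI)
  have "?avg = real_diag (m + 1) \<kappa>"
  proof -
    have "- mat_adjoint x * - x = mat_adjoint x * x" "mat_adjoint S * - x = - (mat_adjoint S * x)"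
      "- mat_adjoint x * S = - (mat_adjoint x * S)"
      using x xa S Sa by auto
    then show ?thesis
      unfolding PD QD xm using S x xx
      by (intro eq_matI) (auto simp: mat_diag_def \<kappa>_def simp del: index_mult_mat(1))
  qed
  also have "\<dots> = unitary_diag (m + 1) (1\<^sub>m (m + 1)) \<kappa>"
    by (simp add: unitary_diag_def left_mult_one_mat[OF mat_diag_dim] right_mult_one_mat[OF mat_diag_dim])
  finally have avg: "?avg = unitary_diag (m + 1) (1\<^sub>m (m + 1)) \<kappa>" .
  have "loewner_le (fun_calc f ?avg)
      (?h \<cdot>\<^sub>m fun_calc f (unitary_diag (m + 1) P \<nu>) + complex_of_real (1 - 1 / 2) \<cdot>\<^sub>m fun_calc f (unitary_diag (m + 1) Q \<nu>))"
    by (rule matrix_convexD[OF conv]) (use P Q \<nu>J in \<open>auto simp: selfadjoint_unitary_diag eigenvalues_in_unitary_diag\<close>)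
  then have "loewner_le (unitary_diag (m + 1) (1\<^sub>m (m + 1)) (\<lambda>i. f (\<kappa> i)))
      (?h \<cdot>\<^sub>m unitary_diag (m + 1) P (\<lambda>i. f (\<nu> i)) + complex_of_real (1 - 1 / 2) \<cdot>\<^sub>m unitary_diag (m + 1) Q (\<lambda>i. f (\<nu> i)))"
    unfolding avg fun_calc_unitary_diag[OF P] fun_calc_unitary_diag[OF Q] fun_calc_unitary_diag[OF I] .
  then have "qform (unitary_diag (m + 1) (1\<^sub>m (m + 1)) (\<lambda>i. f (\<kappa> i))) u \<le>
      qform (?h \<cdot>\<^sub>m unitary_diag (m + 1) P (\<lambda>i. f (\<nu> i)) + complex_of_real (1 - 1 / 2) \<cdot>\<^sub>m unitary_diag (m + 1) Q (\<lambda>i. f (\<nu> i))) u"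
    by (rule loewner_leD) (use P Q I u in auto)
  also have "\<dots> = 1 / 2 * qform (unitary_diag (m + 1) P (\<lambda>i. f (\<nu> i))) u + (1 - 1 / 2) * qform (unitary_diag (m + 1) Q (\<lambda>i. f (\<nu> i))) u"
    using P Q u by (subst qform_add[of _ "m + 1"]) (auto simp only: qform_smult[of _ "m + 1"] unitary_diag_carrier smult_carrier_mat)
  also have "\<dots> \<le> qform (unitary_diag m V (\<lambda>i. f (\<mu> i) / \<mu> i)) v"
    using Pq Qq by simp
  \<comment> \<open>The last coordinate of \<open>u\<close> is 0, so the value of \<open>f\<close>
    at the corner entry \<open>t\<close> drops out.\<close>
  also have "qform (unitary_diag (m + 1) (1\<^sub>m (m + 1)) (\<lambda>i. f (\<kappa> i))) u =
      (\<Sum>i<m. f (lam i) * (cmod (w $ i))\<^sup>2)"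
    using w u unfolding qform_unitary_diag[OF I(1) u] by (simp add: \<kappa>_def u_def)
  also have "\<dots> = (\<Sum>i<m. f (lam i) / lam i * (cmod ((mat_adjoint W *\<^sub>v v) $ i))\<^sup>2)"
  proof (rule sum.cong)
    fix i assume "i \<in> {..<m}"
    then have i: "i < m" by simp
    have "w = D' *\<^sub>v (mat_adjoint W *\<^sub>v v)"
      unfolding w_def R_def using D' Wa v by (simp add: assoc_mult_mat_vec[of _ m m _ m])
    then have "w $ i = (mat_adjoint W *\<^sub>v v) $ i / complex_of_real (sqrt (lam i))"
      using Wa v i by (simp add: D'_def mat_diag_mult_vec mult_mat_vec_carrier[of _ m m] del: index_mult_mat_vec)
    then show "f (lam i) * (cmod (w $ i))\<^sup>2 = f (lam i) / lam i * (cmod ((mat_adjoint W *\<^sub>v v) $ i))\<^sup>2"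
      using lam[OF i] by (simp add: norm_divide power_divide del: index_mult_mat_vec)
  qed simp
  also have "\<dots> = qform (unitary_diag m W (\<lambda>i. f (lam i) / lam i)) v"
    by (rule qform_unitary_diag[OF W(1) v, symmetric])
  finally show ?thesis .
qed

section \<open>From rank one increases to arbitrary ones\<close>

lemma qform_column_square:
  assumes x: "x \<in> carrier_mat n 1" and v: "v \<in> carrier_vec n"
  shows "qform (x * mat_adjoint x) v \<ge> 0"
proof -
  define y where "y = mat_adjoint x *\<^sub>v v"
  have y: "y \<in> carrier_vec 1" using mat_adjoint_carrier[OF x] v by (simp add: y_def)
  have "(x * mat_adjoint x) *\<^sub>v v = x *\<^sub>v y"
    unfolding y_def using x mat_adjoint_carrier[OF x] v by (simp add: assoc_mult_mat_vec[of _ n 1 _ n])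
  then have "((x * mat_adjoint x) *\<^sub>v v) \<bullet>c v = y \<bullet>c y"
    using cscalar_prod_mult_mat_left[OF x y v] by (simp add: y_def)
  then show ?thesis
    unfolding cscalar_prod_self[OF y] by (simp add: qform_def sum_nonneg)
qed

lemma fun_calc_carrier:
  assumes "A \<in> carrier_mat n n" "selfadjoint_mat A"
  shows "fun_calc f A \<in> carrier_mat n n" "selfadjoint_mat (fun_calc f A)"
proof -
  obtain U d where "U \<in> carrier_mat n n" "unitary_mat U" "A = unitary_diag n U d"
    using spectral_decomposition[OF assms] .
  then show "fun_calc f A \<in> carrier_mat n n" "selfadjoint_mat (fun_calc f A)"
    by (simp_all add: fun_calc_unitary_diag selfadjoint_unitary_diag)
qed

text \<open>Switching on the eigenvalue \<open>d k\<close> adds its spectral component, which is the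
  square of column \<open>k\<close> of \<open>U\<close> scaled by sqrt (\<open>d k\<close>).\<close>

lemma unitary_diag_rank_one_update:
  assumes U: "U \<in> carrier_mat n n" and k: "k < n" and d: "d k \<ge> 0"
  obtains x where "x \<in> carrier_mat n 1"
    "unitary_diag n U (\<lambda>i. if i < Suc k then d i else 0) = unitary_diag n U (\<lambda>i. if i < k then d i else 0) + x * mat_adjoint x"
proof -
  define e where "e = mat n 1 (\<lambda>(i, _). if i = k then complex_of_real (sqrt (d k)) else 0)"
  have e: "e \<in> carrier_mat n 1" by (simp add: e_def)
  note ca = mat_adjoint_carrier[OF U] mat_adjoint_carrier[OF e]
  let ?d = "\<lambda>k i. if i < k then d i else 0"
  have "(e * mat_adjoint e) $$ (i, j) = (if i = j \<and> i = k then complex_of_real (d k) else 0)" if "i < n" "j < n" for i j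
    using that d by (auto simp: e_def scalar_prod_def simp flip: of_real_mult)
  then have ee: "real_diag n (?d (Suc k)) = real_diag n (?d k) + e * mat_adjoint e"
    using e ca by (intro eq_matI) (auto simp: mat_diag_def less_Suc_eq simp del: index_mult_mat(1))
  have "unitary_diag n U (?d (Suc k)) = U * real_diag n (?d k) * mat_adjoint U + U * (e * mat_adjoint e) * mat_adjoint U"
    unfolding unitary_diag_def ee using U e ca
    by (subst mult_add_distrib_mat[of _ n n _ n]) (auto intro!: add_mult_distrib_mat[of _ n n])
  also have "U * (e * mat_adjoint e) * mat_adjoint U = (U * e) * mat_adjoint (U * e)"
    using carrier_matD[OF U] carrier_matD[OF e] by (simp add: mat_adjoint_mult mat_mult_assoc)
  finally show ?thesis
    using that[of "U * e"] U e by (auto simp: unitary_diag_def)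
qed

lemma loewner_le_quotient_rank_one:
  assumes conv: "matrix_convex (m + 1) J f" and J0: "0 \<in> J" and f0: "f 0 \<le> 0"
    and IJ: "I \<subseteq> J" and Ipos: "\<And>t. t \<in> I \<Longrightarrow> t > 0"
    and a: "a \<in> carrier_mat m m" "selfadjoint_mat a" "eigenvalues_in a I"
    and b: "b \<in> carrier_mat m m" "selfadjoint_mat b" "eigenvalues_in b I"
    and x: "x \<in> carrier_mat m 1" and eq: "b = a + x * mat_adjoint x" and v: "v \<in> carrier_vec m"
  shows "qform (fun_calc (\<lambda>t. f t / t) a) v \<le> qform (fun_calc (\<lambda>t. f t / t) b) v"
proof -
  obtain W lam where W: "W \<in> carrier_mat m m" "unitary_mat W" and al: "a = unitary_diag m W lam"
    using spectral_decomposition[OF a(1,2)] .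
  obtain V \<mu> where V: "V \<in> carrier_mat m m" "unitary_mat V" and b\<mu>: "b = unitary_diag m V \<mu>"
    using spectral_decomposition[OF b(1,2)] .
  have "lam i \<in> I" "\<mu> i \<in> I" if "i < m" for i
    using a(3) b(3) eigenvalues_in_unitary_diag[OF W] eigenvalues_in_unitary_diag[OF V] that
    unfolding al b\<mu> by auto
  then have "qform (unitary_diag m W (\<lambda>i. f (lam i) / lam i)) v \<le> qform (unitary_diag m V (\<lambda>i. f (\<mu> i) / \<mu> i)) v"
    using eq IJ Ipos unfolding al b\<mu>
    by (intro matrix_convex_rank_one_step[OF conv J0 f0 W _ V _ _ x _ v]) auto
  then show ?thesis
    unfolding al b\<mu> fun_calc_unitary_diag[OF W] fun_calc_unitary_diag[OF V] .
qed

text \<open>Two sets are kept apart: \<open>J\<close> carries the convexity and contains the kernel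
  eigenvalue 0, while \<open>I\<close> is an order convex set of positive numbers on which the
  quotient is taken.\<close>

lemma matrix_monotone_quotient:
  assumes conv: "matrix_convex (m + 1) J f" and J0: "0 \<in> J" and f0: "f 0 \<le> 0"
    and IJ: "I \<subseteq> J" and Ipos: "\<And>t. t \<in> I \<Longrightarrow> t > 0"
    and I: "\<And>x y z. x \<in> I \<Longrightarrow> z \<in> I \<Longrightarrow> x \<le> y \<Longrightarrow> y \<le> z \<Longrightarrow> y \<in> I"
  shows "matrix_monotone m I (\<lambda>t. f t / t)"
  unfolding matrix_monotone_def
proof (intro ballI impI)
  fix a b :: "complex mat"
  assume a: "a \<in> carrier_mat m m" "selfadjoint_mat a" "eigenvalues_in a I"
    and b: "b \<in> carrier_mat m m" "selfadjoint_mat b" "eigenvalues_in b I" and le: "loewner_le a b"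
  let ?g = "\<lambda>t. f t / t"
  have c: "b - a \<in> carrier_mat m m" "selfadjoint_mat (b - a)"
    using a b le by (auto simp: loewner_le_def positive_mat_def)
  obtain U d where U: "U \<in> carrier_mat m m" "unitary_mat U" and bd: "b - a = unitary_diag m U d"
    using spectral_decomposition[OF c] .
  have d: "d k \<ge> 0" if k: "k < m" for k
  proof -
    have v: "col U k \<in> carrier_vec m" using U k by simp
    have "0 \<le> qform (b - a) (col U k)"
      using le v a(1) b(1) by (auto simp: loewner_le_def positive_mat_def qform_def)
    then show ?thesis unfolding bd qform_unitary_diag_col[OF U k] .
  qed
  \<comment> \<open>A path from \<open>a\<close> to \<open>b\<close> that adds the spectral
    components of \<open>b - a\<close> one at a time; the nonnegative eigenvalues make each step a
    rank one increase of the form \<open>x * mat_adjoint x\<close>.\<close>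
  define h where "h = (\<lambda>k. a + unitary_diag m U (\<lambda>i. if i < k then d i else 0))"
  have h: "h k \<in> carrier_mat m m" "selfadjoint_mat (h k)" for k
    using a U by (auto simp: h_def selfadjoint_add[of _ m] selfadjoint_unitary_diag)
  have h0: "h 0 = a"
  proof -
    have "unitary_diag m U (\<lambda>_. 0) = 0\<^sub>m m m"
    proof -
      have "real_diag m (\<lambda>_. 0) = 0\<^sub>m m m" by (intro eq_matI) (auto simp: mat_diag_def)
      then show ?thesis using carrier_matD[OF U(1)] by (simp add: unitary_diag_def)
    qed
    then show ?thesis using a by (simp add: h_def)
  qed
  have hm: "h m = b"
  proof -
    have "unitary_diag m U (\<lambda>i. if i < m then d i else 0) = b - a"
      unfolding bd unitary_diag_def by (simp cong: mat_diag_cong)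
    then show ?thesis using carrier_matD[OF a(1)] carrier_matD[OF b(1)]
      by (intro eq_matI) (auto simp: h_def)
  qed
  have step: "\<exists>x \<in> carrier_mat m 1. h (Suc k) = h k + x * mat_adjoint x" if k: "k < m" for k
  proof -
    obtain x where "x \<in> carrier_mat m 1" "unitary_diag m U (\<lambda>i. if i < Suc k then d i else 0) =
        unitary_diag m U (\<lambda>i. if i < k then d i else 0) + x * mat_adjoint x"
      using unitary_diag_rank_one_update[of U m k d, OF U(1) k d[OF k]] .
    then show ?thesis
      using a U unfolding h_def
      by (auto intro!: bexI[of _ x] assoc_add_mat[symmetric, of _ m m] mult_carrier_mat[of _ m 1] mat_adjoint_carrier)
  qed
  have mono: "qform (h k) v \<le> qform (h l) v" if "k \<le> l" "l \<le> m" and v: "v \<in> carrier_vec m" for k l v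
    using that(1,2)
  proof (induction l rule: dec_induct)
    case (step l)
    then obtain x where x: "x \<in> carrier_mat m 1" "h (Suc l) = h l + x * mat_adjoint x"
      using \<open>\<And>k. k < m \<Longrightarrow> \<exists>x \<in> carrier_mat m 1. h (Suc k) = h k + x * mat_adjoint x\<close>[of l] by auto
    then have "qform (h (Suc l)) v = qform (h l) v + qform (x * mat_adjoint x) v"
      using h v by (simp add: qform_add[of _ m] mat_adjoint_carrier mult_carrier_mat[of _ m 1])
    then show ?case using step qform_column_square[OF x(1) v] by simp
  qed simp
  \<comment> \<open>By \<open>mono\<close>, \<open>h k\<close> lies between \<open>h 0 = a\<close>
    and \<open>h m = b\<close>, so its spectrum cannot leave \<open>I\<close> and the rank one case
    applies to each step.\<close>
  have hI: "eigenvalues_in (h k) I" if "k \<le> m" for k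
    by (rule eigenvalues_in_between[OF I a b h])
      (use mono[of 0 k] mono[of k m] h0 hm that in auto)
  have "qform (fun_calc ?g a) v \<le> qform (fun_calc ?g (h k)) v" if "k \<le> m" and v: "v \<in> carrier_vec m" for k v
    using that(1)
  proof (induction k)
    case 0
    then show ?case by (simp add: h0)
  next
    case (Suc k)
    then obtain x where x: "x \<in> carrier_mat m 1" "h (Suc k) = h k + x * mat_adjoint x"
      using step[of k] by auto
    have "qform (fun_calc ?g (h k)) v \<le> qform (fun_calc ?g (h (Suc k))) v"
      by (rule loewner_le_quotient_rank_one[OF conv J0 f0 IJ Ipos h hI h hI x v]) (use Suc in auto)
    then show ?case using Suc by simp
  qed
  from this[of m] show "loewner_le (fun_calc ?g a) (fun_calc ?g b)"
    unfolding hm by (intro loewner_leI[of _ m] fun_calc_carrier[of _ m] a b) auto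
qed

theorem theorem3p2:
  fixes n :: nat and \<alpha> :: ereal and f :: "real \<Rightarrow> real"
  assumes "n \<ge> 2"
    and "0 < \<alpha>"
    and "continuous_on {t. 0 \<le> t \<and> ereal t < \<alpha>} f"
    and "f 0 \<le> 0"
    and "matrix_convex n {t. 0 \<le> t \<and> ereal t < \<alpha>} f"
  shows "matrix_monotone (n - 1) {t. 0 < t \<and> ereal t < \<alpha>} (\<lambda>t. f t / t)"
proof (rule matrix_monotone_quotient)
  \<comment> \<open>Here \<open>m\<close> is \<open>n - 1\<close>, \<open>J\<close> is the interval
    with 0 and \<open>I\<close> the one without it; \<open>n \<ge> 2\<close> ensures that the
    truncated subtraction gives \<open>n - 1 + 1 = n\<close>.\<close>
  show "matrix_convex (n - 1 + 1) {t. 0 \<le> t \<and> ereal t < \<alpha>} f"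
    using assms(1,5) by simp
  show "y \<in> {t. 0 < t \<and> ereal t < \<alpha>}"
    if "x \<in> {t. 0 < t \<and> ereal t < \<alpha>}" "z \<in> {t. 0 < t \<and> ereal t < \<alpha>}" "x \<le> y" "y \<le> z" for x y z
    using that by (auto intro: le_less_trans[of "ereal y" "ereal z"])
qed (use assms(2,4) in \<open>auto simp: zero_ereal_def\<close>)

end
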